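(* Let $(\mathsf{A},\Delta)$ be a compact quantum group whose Haar state $h$ is faithful on $\mathsf{A}$, with dense Hopf $*$-algebra $\mathcal{A}$. Consider the generating functional $\phi\in\mathcal{A}'$ of a Lévy process on $\mathcal{A}$, its associated Schürmann triple $((\pi,H_\pi),\eta,\phi)$ on a Hilbert space $H_\pi$, and the induced $\mathsf{A}$-bimodule structure on the Hilbert space $L^2(\mathsf{A},h)\otimes H_\pi$, with left action $a\cdot\xi=\rho_L(a)\xi$ and right action $\xi\cdot a=\rho_R(a)\xi$ ($a\in\mathsf{A}$, $\xi\in L^2(\mathsf{A},h)\otimes H_\pi$). Then the linear map $$\partial:\mathcal{A}\to L^2(\mathsf{A},h)\otimes H_\pi,\qquad \partial:=(i_h\otimes\eta)\circ\Delta,$$ or, more explicitly, $\partial a=\sum a_{(1)}\xi_h\otimes\eta(a_{(2)})$ for $a\in\mathcal{A}$, is a derivation, in the sense that it satisfies the Leibniz rule $$\partial(ab)=(\partial a)\cdot b+a\cdot(\partial b),\qquad a,b\in\mathcal{A}.$$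
   Context: $\mathcal{A}\subseteq\mathsf{A}$ is the dense Hopf $*$-algebra spanned by the coefficients of finite-dimensional unitary corepresentations, with counit $\varepsilon$; $\mathcal{A}'$ is the space of linear functionals on $\mathcal{A}$. $h$ is the Haar state, $L^2(\mathsf{A},h)$ its GNS Hilbert space with cyclic vector $\xi_h$, and $i_h(a)=a\xi_h$ for $a\in\mathsf{A}$. Sweedler notation: $\Delta(a)=\sum a_{(1)}\otimes a_{(2)}$. A generating functional of a Lévy process on $\mathcal{A}$ is a hermitian linear functional $\phi$ with $\phi(\mathbf{1})=0$ and $\phi(a^*a)\ge0$ for $a\in\ker\varepsilon$. Its associated Schürmann triple $((\pi,H_\pi),\eta,\phi)$ (unique up to unitary equivalence) consists of a unital $*$-representation $\pi$ of $\mathcal{A}$ by bounded operators on a Hilbert space $H_\pi$, a linear map $\eta:\mathcal{A}\to H_\pi$ with dense image satisfying $\eta(ab)=\pi(a)\eta(b)+\eta(a)\varepsilon(b)$ for $a,b\in\mathcal{A}$, and $\phi$ itself, with $\phi(ab)=\langle\eta(a^* ),\eta(b)\rangle$ for $a,b\in\ker\varepsilon$. In this setting $\pi$ is regarded as a representation of the C$^*$-algebra $\mathsf{A}$. Bimodule structure: let $\lambda_L,\lambda_R:\mathsf{A}\to B(L^2(\mathsf{A},h))$ be the left and right actions $\lambda_L(a)(b\xi_h)=ab\xi_h$, $\lambda_R(a)(b\xi_h)=ba\xi_h$ ($a,b\in\mathsf{A}$). The actions $\rho_L,\rho_R:\mathsf{A}\to B(L^2(\mathsf{A},h)\otimes H_\pi)$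 are $$\rho_L=(\lambda_L\otimes\pi)\circ\Delta,\qquad \rho_R=\lambda_R\otimes\mathrm{id}_{H_\pi},$$ that is, $\rho_L(a)(b\xi_h\otimes v)=\sum a_{(1)}b\xi_h\otimes\pi(a_{(2)})v$ and $\rho_R(a)(b\xi_h\otimes v)=ba\xi_h\otimes v$ for $a,b\in\mathsf{A}$, $v\in H_\pi$. They are taken to be continuous and commuting, $\rho_L$ being a representation and $\rho_R$ an antirepresentation of $\mathsf{A}$, so that $L^2(\mathsf{A},h)\otimes H_\pi$ is an $\mathsf{A}$-bimodule. *)

theory Defs
  imports "HOL-Analysis.Analysis" "HOL-Library.Nonpos_Ints"
begin

section \<open>Complex vector spaces, Hilbert spaces, unital C*-algebras\<close>

class complex_vector = real_vector +
  fixes scaleC :: "complex \<Rightarrow> 'a \<Rightarrow> 'a" (infixr \<open>*\<^sub>C\<close> 75)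
  assumes scaleC_add_right: "c *\<^sub>C (x + y) = c *\<^sub>C x + c *\<^sub>C y"
    and scaleC_add_left: "(c + d) *\<^sub>C x = c *\<^sub>C x + d *\<^sub>C x"
    and scaleC_scaleC: "c *\<^sub>C (d *\<^sub>C x) = (c * d) *\<^sub>C x"
    and scaleC_one: "1 *\<^sub>C x = x"
    and scaleR_scaleC: "scaleR r x = complex_of_real r *\<^sub>C x"

global_interpretation complex_vector:
  vector_space "scaleC :: complex \<Rightarrow> 'a \<Rightarrow> 'a::complex_vector"
  defines cspan = complex_vector.span
    and cindependent = complex_vector.independent
  by unfold_locales
    (simp_all add: scaleC_add_right scaleC_add_left scaleC_scaleC scaleC_one)

abbreviation clinear :: "('a::complex_vector \<Rightarrow> 'b::complex_vector) \<Rightarrow> bool" where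
  "clinear \<equiv> Vector_Spaces.linear scaleC scaleC"

class complex_normed_vector = complex_vector + real_normed_vector +
  assumes norm_scaleC: "norm (c *\<^sub>C x) = cmod c * norm x"

text \<open>Inner products are conjugate linear in the first and linear in the second argument.\<close>

class chilbert_space = complex_normed_vector + banach +
  fixes cinner :: "'a \<Rightarrow> 'a \<Rightarrow> complex"
  assumes cinner_commute: "cinner x y = cnj (cinner y x)"
    and cinner_add_right: "cinner x (y + z) = cinner x y + cinner x z"
    and cinner_scaleC_right: "cinner x (c *\<^sub>C y) = c * cinner x y"
    and cinner_norm: "cinner x x = complex_of_real ((norm x)\<^sup>2)"

class unital_cstar_algebra = complex_normed_vector + real_normed_algebra_1 + banach +
  fixes star :: "'a \<Rightarrow> 'a"
  assumes mult_scaleC_left: "(c *\<^sub>C x) * y = c *\<^sub>C (x * y)"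
    and mult_scaleC_right: "x * (c *\<^sub>C y) = c *\<^sub>C (x * y)"
    and star_add: "star (x + y) = star x + star y"
    and star_scaleC: "star (c *\<^sub>C x) = cnj c *\<^sub>C star x"
    and star_mult: "star (x * y) = star y * star x"
    and star_star: "star (star x) = x"
    and cstar_identity: "norm (star x * x) = (norm x)\<^sup>2"

instantiation complex :: complex_normed_vector
begin
definition scaleC_complex :: "complex \<Rightarrow> complex \<Rightarrow> complex" where
  "scaleC_complex c x = c * x"
instance
  by standard (simp_all add: scaleC_complex_def algebra_simps norm_mult scaleR_conv_of_real)
end

instantiation complex :: chilbert_space
begin
definition cinner_complex :: "complex \<Rightarrow> complex \<Rightarrow> complex" where
  "cinner_complex x y = cnj x * y"
instance
proof
  fix x :: complex
  show "cinner x x = complex_of_real ((norm x)\<^sup>2)"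
    by (simp only: cinner_complex_def complex_norm_square mult.commute)
qed (simp_all add: cinner_complex_def scaleC_complex_def algebra_simps)
end

instantiation complex :: unital_cstar_algebra
begin
definition star_complex :: "complex \<Rightarrow> complex" where
  "star_complex = cnj"
instance
  by standard (simp_all add: star_complex_def scaleC_complex_def algebra_simps norm_mult power2_eq_square)
end

definition bounded_clinear ::
    "('a::complex_normed_vector \<Rightarrow> 'b::complex_normed_vector) \<Rightarrow> bool" where
  "bounded_clinear f \<longleftrightarrow> clinear f \<and> (\<exists>K. \<forall>x. norm (f x) \<le> K * norm x)"

definition cbilinear ::
    "('a::complex_vector \<Rightarrow> 'b::complex_vector \<Rightarrow> 'c::complex_vector) \<Rightarrow> bool" where
  "cbilinear f \<longleftrightarrow> (\<forall>y. clinear (\<lambda>x. f x y)) \<and> (\<forall>x. clinear (f x))"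

text \<open>Maps defined only on a linear subspace are represented by total functions whose values
  outside the subspace are irrelevant.\<close>

definition clinear_on ::
    "'a::complex_vector set \<Rightarrow> ('a \<Rightarrow> 'b::complex_vector) \<Rightarrow> bool" where
  "clinear_on S f \<longleftrightarrow>
     (\<forall>x\<in>S. \<forall>y\<in>S. f (x + y) = f x + f y) \<and> (\<forall>c. \<forall>x\<in>S. f (c *\<^sub>C x) = c *\<^sub>C f x)"

definition unital_star_hom ::
    "('a::unital_cstar_algebra \<Rightarrow> 'b::unital_cstar_algebra) \<Rightarrow> bool" where
  "unital_star_hom f \<longleftrightarrow> clinear f \<and> (\<forall>x y. f (x * y) = f x * f y) \<and> f 1 = 1
     \<and> (\<forall>x. f (star x) = star (f x))"

definition star_rep ::
    "('a::unital_cstar_algebra \<Rightarrow> 'h::chilbert_space \<Rightarrow> 'h) \<Rightarrow> bool" where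
  "star_rep p \<longleftrightarrow>
     (\<forall>a. bounded_clinear (p a)) \<and> (\<forall>v. clinear (\<lambda>a. p a v))
     \<and> (\<forall>a b. p (a * b) = p a \<circ> p b) \<and> p 1 = id
     \<and> (\<forall>a v w. cinner (p (star a) v) w = cinner v (p a w))"

definition state :: "('a::unital_cstar_algebra \<Rightarrow> complex) \<Rightarrow> bool" where
  "state f \<longleftrightarrow> clinear f \<and> f 1 = 1 \<and> (\<forall>a. f (star a * a) \<in> \<real>\<^sub>\<ge>\<^sub>0)"

definition faithful :: "('a::unital_cstar_algebra \<Rightarrow> complex) \<Rightarrow> bool" where
  "faithful f \<longleftrightarrow> (\<forall>a. f (star a * a) = 0 \<longrightarrow> a = 0)"


section \<open>Tensor products\<close>

text \<open>For a bilinear \<open>f\<close>, the map \<open>\<Sum> t (a i) (b i) \<mapsto> \<Sum> f (a i) (b i)\<close> on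
  the image under \<open>t\<close> of the algebraic tensor product of the subspaces \<open>S\<close> and \<open>T\<close>.
  It is used only for \<open>t\<close> inducing an injection of that algebraic tensor product,
  so that the value does not depend on the chosen representation of \<open>x\<close>.\<close>

definition alg_tensor_map ::
    "'a set \<Rightarrow> 'b set \<Rightarrow> ('a \<Rightarrow> 'b \<Rightarrow> 'c::comm_monoid_add) \<Rightarrow> ('a \<Rightarrow> 'b \<Rightarrow> 'd::comm_monoid_add)
      \<Rightarrow> 'c \<Rightarrow> 'd" where
  "alg_tensor_map S T t f x =
     (THE y. \<exists>(n::nat) a b. (\<forall>i<n. a i \<in> S \<and> b i \<in> T)
        \<and> x = (\<Sum>i<n. t (a i) (b i)) \<and> y = (\<Sum>i<n. f (a i) (b i)))"

definition alg_tensor ::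
    "('a \<Rightarrow> 'b \<Rightarrow> 'c::complex_vector) \<Rightarrow> 'c set" where
  "alg_tensor t = cspan {t a b | a b. True}"

text \<open>\<open>min_tensor t\<close> says that \<open>t\<close>, \<open>(a, b) \<mapsto> a \<otimes> b\<close>, exhibits the C*-algebra \<open>'c\<close> as the
  minimal (spatial) tensor product of \<open>'a\<close> and \<open>'b\<close>, i.e. as the completion of the algebraic
  tensor product in the norm
  \<open>\<parallel>x\<parallel> = sup \<parallel>(\<pi>\<^sub>f \<otimes> \<pi>\<^sub>g) x\<parallel>\<close>, where \<open>f\<close>, \<open>g\<close> range over the states of \<open>'a\<close>, \<open>'b\<close>
  and \<open>\<pi>\<^sub>f\<close>, \<open>\<pi>\<^sub>g\<close> are their GNS representations.  The operator norm is written out on the dense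
  set of vectors \<open>(\<pi>\<^sub>f \<otimes> \<pi>\<^sub>g)(y)(\<xi>\<^sub>f \<otimes> \<xi>\<^sub>g)\<close>, whose squared norm is \<open>(f \<otimes> g)(y\<^sup>* y)\<close>.\<close>

definition min_tensor ::
    "('a::unital_cstar_algebra \<Rightarrow> 'b::unital_cstar_algebra \<Rightarrow> 'c::unital_cstar_algebra) \<Rightarrow> bool" where
  "min_tensor t \<longleftrightarrow>
     cbilinear t
     \<and> (\<forall>a b a' b'. t a b * t a' b' = t (a * a') (b * b'))
     \<and> t 1 1 = 1
     \<and> (\<forall>a b. star (t a b) = t (star a) (star b))
     \<and> (\<forall>(n::nat) a b. inj_on b {..<n} \<longrightarrow> cindependent (b ` {..<n}) \<longrightarrow>
           (\<Sum>i<n. t (a i) (b i)) = 0 \<longrightarrow> (\<forall>i<n. a i = 0))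
     \<and> (\<forall>x\<in>alg_tensor t. (norm x)\<^sup>2 =
           Sup {Re (alg_tensor_map UNIV UNIV t (\<lambda>a b. f a * g b) (star y * star x * x * y)) | f g y.
                state f \<and> state g \<and> y \<in> alg_tensor t
                \<and> alg_tensor_map UNIV UNIV t (\<lambda>a b. f a * g b) (star y * y) = 1})
     \<and> closure (alg_tensor t) = UNIV"

text \<open>The *-homomorphism \<open>p \<otimes> q\<close> between minimal tensor products.\<close>

definition tensor_hom ::
    "('a::unital_cstar_algebra \<Rightarrow> 'b::unital_cstar_algebra \<Rightarrow> 'c::unital_cstar_algebra)
      \<Rightarrow> ('d::unital_cstar_algebra \<Rightarrow> 'e::unital_cstar_algebra \<Rightarrow> 'f::unital_cstar_algebra)
      \<Rightarrow> ('a \<Rightarrow> 'd) \<Rightarrow> ('b \<Rightarrow> 'e) \<Rightarrow> 'c \<Rightarrow> 'f" where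
  "tensor_hom t t' p q =
     (THE F. unital_star_hom F \<and> (\<forall>a b. F (t a b) = t' (p a) (q b)))"

text \<open>The slice maps \<open>f \<otimes> id\<close> and \<open>id \<otimes> f\<close>.\<close>

definition slice_left ::
    "('a::unital_cstar_algebra \<Rightarrow> 'b::unital_cstar_algebra \<Rightarrow> 'c::unital_cstar_algebra)
      \<Rightarrow> ('a \<Rightarrow> complex) \<Rightarrow> 'c \<Rightarrow> 'b" where
  "slice_left t f = (THE F. bounded_clinear F \<and> (\<forall>a b. F (t a b) = f a *\<^sub>C b))"

definition slice_right ::
    "('a::unital_cstar_algebra \<Rightarrow> 'b::unital_cstar_algebra \<Rightarrow> 'c::unital_cstar_algebra)
      \<Rightarrow> ('b \<Rightarrow> complex) \<Rightarrow> 'c \<Rightarrow> 'a" where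
  "slice_right t f = (THE F. bounded_clinear F \<and> (\<forall>a b. F (t a b) = f b *\<^sub>C a))"

text \<open>\<open>t\<close> exhibits \<open>'k\<close> as the Hilbert space tensor product of \<open>'l\<close> and \<open>'h\<close>.\<close>

definition hilbert_tensor ::
    "('l::chilbert_space \<Rightarrow> 'h::chilbert_space \<Rightarrow> 'k::chilbert_space) \<Rightarrow> bool" where
  "hilbert_tensor t \<longleftrightarrow>
     cbilinear t
     \<and> (\<forall>x x' y y'. cinner (t x y) (t x' y') = cinner x x' * cinner y y')
     \<and> closure (alg_tensor t) = UNIV"

text \<open>\<open>W = S \<otimes> T\<close> as bounded operators on the tensor product; \<open>W\<close> is unique by density.\<close>

definition is_tensor_op ::
    "('l::chilbert_space \<Rightarrow> 'h::chilbert_space \<Rightarrow> 'k::chilbert_space)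
      \<Rightarrow> ('l \<Rightarrow> 'l) \<Rightarrow> ('h \<Rightarrow> 'h) \<Rightarrow> ('k \<Rightarrow> 'k) \<Rightarrow> bool" where
  "is_tensor_op t S T W \<longleftrightarrow> bounded_clinear W \<and> (\<forall>x y. W (t x y) = t (S x) (T y))"

text \<open>\<open>F = p \<otimes> q\<close> as the representation of the minimal tensor product on the Hilbert space
  tensor product; \<open>F\<close> is unique by density and automatic continuity of *-representations.\<close>

definition is_tensor_rep ::
    "('a::unital_cstar_algebra \<Rightarrow> 'b::unital_cstar_algebra \<Rightarrow> 'c::unital_cstar_algebra)
      \<Rightarrow> ('l::chilbert_space \<Rightarrow> 'h::chilbert_space \<Rightarrow> 'k::chilbert_space)
      \<Rightarrow> ('a \<Rightarrow> 'l \<Rightarrow> 'l) \<Rightarrow> ('b \<Rightarrow> 'h \<Rightarrow> 'h) \<Rightarrow> ('c \<Rightarrow> 'k \<Rightarrow> 'k) \<Rightarrow> bool" where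
  "is_tensor_rep t tH p q F \<longleftrightarrow>
     star_rep F \<and> (\<forall>a b. is_tensor_op tH (p a) (q b) (F (t a b)))"


section \<open>Compact quantum groups\<close>

text \<open>\<open>t2\<close> realises \<open>A \<otimes> A\<close>; \<open>tL\<close> and \<open>tR\<close> realise the same triple tensor product as
  \<open>(A \<otimes> A) \<otimes> A\<close> and as \<open>A \<otimes> (A \<otimes> A)\<close>.\<close>

definition compact_quantum_group ::
    "('a::unital_cstar_algebra \<Rightarrow> 'a \<Rightarrow> 'aa::unital_cstar_algebra)
      \<Rightarrow> ('aa \<Rightarrow> 'a \<Rightarrow> 'aaa::unital_cstar_algebra) \<Rightarrow> ('a \<Rightarrow> 'aa \<Rightarrow> 'aaa)
      \<Rightarrow> ('a \<Rightarrow> 'aa) \<Rightarrow> bool" where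
  "compact_quantum_group t2 tL tR \<Delta> \<longleftrightarrow>
     min_tensor t2 \<and> min_tensor tL \<and> min_tensor tR
     \<and> (\<forall>a b c. tL (t2 a b) c = tR a (t2 b c))
     \<and> unital_star_hom \<Delta>
     \<and> tensor_hom t2 tL \<Delta> id \<circ> \<Delta> = tensor_hom t2 tR id \<Delta> \<circ> \<Delta>
     \<and> closure (cspan {\<Delta> a * t2 b 1 | a b. True}) = UNIV
     \<and> closure (cspan {\<Delta> a * t2 1 b | a b. True}) = UNIV"

definition haar_state ::
    "('a::unital_cstar_algebra \<Rightarrow> 'a \<Rightarrow> 'aa::unital_cstar_algebra) \<Rightarrow> ('a \<Rightarrow> 'aa)
      \<Rightarrow> ('a \<Rightarrow> complex) \<Rightarrow> bool" where
  "haar_state t2 \<Delta> h \<longleftrightarrow> state h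
     \<and> (\<forall>a. slice_left t2 h (\<Delta> a) = h a *\<^sub>C 1)
     \<and> (\<forall>a. slice_right t2 h (\<Delta> a) = h a *\<^sub>C 1)"

definition unitary_corep ::
    "('a::unital_cstar_algebra \<Rightarrow> 'a \<Rightarrow> 'aa::unital_cstar_algebra) \<Rightarrow> ('a \<Rightarrow> 'aa)
      \<Rightarrow> nat \<Rightarrow> (nat \<Rightarrow> nat \<Rightarrow> 'a) \<Rightarrow> bool" where
  "unitary_corep t2 \<Delta> n u \<longleftrightarrow>
     (\<forall>i<n. \<forall>j<n. (\<Sum>k<n. star (u k i) * u k j) = (if i = j then 1 else 0))
     \<and> (\<forall>i<n. \<forall>j<n. (\<Sum>k<n. u i k * star (u j k)) = (if i = j then 1 else 0))
     \<and> (\<forall>i<n. \<forall>j<n. \<Delta> (u i j) = (\<Sum>k<n. t2 (u i k) (u k j)))"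

definition hopf_algebra ::
    "('a::unital_cstar_algebra \<Rightarrow> 'a \<Rightarrow> 'aa::unital_cstar_algebra) \<Rightarrow> ('a \<Rightarrow> 'aa) \<Rightarrow> 'a set" where
  "hopf_algebra t2 \<Delta> = cspan {u i j | n u i j. unitary_corep t2 \<Delta> n u \<and> i < n \<and> j < n}"

text \<open>The counit is determined uniquely by these properties.\<close>

definition counit ::
    "('a::unital_cstar_algebra \<Rightarrow> 'a \<Rightarrow> 'aa::unital_cstar_algebra) \<Rightarrow> ('a \<Rightarrow> 'aa)
      \<Rightarrow> ('a \<Rightarrow> complex) \<Rightarrow> bool" where
  "counit t2 \<Delta> \<epsilon> \<longleftrightarrow>
     (let \<A> = hopf_algebra t2 \<Delta> in
       clinear_on \<A> \<epsilon> \<and> \<epsilon> 1 = 1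
       \<and> (\<forall>a\<in>\<A>. \<forall>b\<in>\<A>. \<epsilon> (a * b) = \<epsilon> a * \<epsilon> b)
       \<and> (\<forall>a\<in>\<A>. \<epsilon> (star a) = cnj (\<epsilon> a))
       \<and> (\<forall>a\<in>\<A>. alg_tensor_map \<A> \<A> t2 (\<lambda>x y. \<epsilon> x *\<^sub>C y) (\<Delta> a) = a)
       \<and> (\<forall>a\<in>\<A>. alg_tensor_map \<A> \<A> t2 (\<lambda>x y. \<epsilon> y *\<^sub>C x) (\<Delta> a) = a))"

text \<open>GNS representation \<open>p\<close> of a state \<open>f\<close> with cyclic vector \<open>\<xi>\<close>, unique up to unitary
  equivalence.\<close>

definition gns ::
    "('a::unital_cstar_algebra \<Rightarrow> complex) \<Rightarrow> ('a \<Rightarrow> 'l::chilbert_space \<Rightarrow> 'l) \<Rightarrow> 'l \<Rightarrow> bool" where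
  "gns f p \<xi> \<longleftrightarrow>
     star_rep p \<and> (\<forall>a. cinner \<xi> (p a \<xi>) = f a) \<and> closure (range (\<lambda>a. p a \<xi>)) = UNIV"


section \<open>Generating functionals, Schuermann triples and the induced bimodule\<close>

definition generating_functional ::
    "('a::unital_cstar_algebra \<Rightarrow> 'a \<Rightarrow> 'aa::unital_cstar_algebra) \<Rightarrow> ('a \<Rightarrow> 'aa)
      \<Rightarrow> ('a \<Rightarrow> complex) \<Rightarrow> ('a \<Rightarrow> complex) \<Rightarrow> bool" where
  "generating_functional t2 \<Delta> \<epsilon> \<phi> \<longleftrightarrow>
     (let \<A> = hopf_algebra t2 \<Delta> in
       clinear_on \<A> \<phi> \<and> (\<forall>a\<in>\<A>. \<phi> (star a) = cnj (\<phi> a)) \<and> \<phi> 1 = 0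
       \<and> (\<forall>a\<in>\<A>. \<epsilon> a = 0 \<longrightarrow> \<phi> (star a * a) \<in> \<real>\<^sub>\<ge>\<^sub>0))"

text \<open>Here \<open>p\<close> is a representation of the whole C*-algebra, whereas \<open>\<eta>\<close> and \<open>\<phi>\<close> live on the
  Hopf *-algebra only.\<close>

definition schuermann_triple ::
    "('a::unital_cstar_algebra \<Rightarrow> 'a \<Rightarrow> 'aa::unital_cstar_algebra) \<Rightarrow> ('a \<Rightarrow> 'aa)
      \<Rightarrow> ('a \<Rightarrow> complex) \<Rightarrow> ('a \<Rightarrow> 'h::chilbert_space \<Rightarrow> 'h) \<Rightarrow> ('a \<Rightarrow> 'h)
      \<Rightarrow> ('a \<Rightarrow> complex) \<Rightarrow> bool" where
  "schuermann_triple t2 \<Delta> \<epsilon> p \<eta> \<phi> \<longleftrightarrow>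
     (let \<A> = hopf_algebra t2 \<Delta> in
       star_rep p
       \<and> clinear_on \<A> \<eta> \<and> closure (\<eta> ` \<A>) = UNIV
       \<and> (\<forall>a\<in>\<A>. \<forall>b\<in>\<A>. \<eta> (a * b) = p a (\<eta> b) + \<epsilon> b *\<^sub>C \<eta> a)
       \<and> (\<forall>a\<in>\<A>. \<forall>b\<in>\<A>. \<epsilon> a = 0 \<longrightarrow> \<epsilon> b = 0 \<longrightarrow>
             \<phi> (a * b) = cinner (\<eta> (star a)) (\<eta> b)))"

text \<open>Continuous commuting left and right actions of a C*-algebra on a Hilbert space.\<close>

definition hilbert_bimodule ::
    "('a::unital_cstar_algebra \<Rightarrow> 'k::chilbert_space \<Rightarrow> 'k) \<Rightarrow> ('a \<Rightarrow> 'k \<Rightarrow> 'k) \<Rightarrow> bool" where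
  "hilbert_bimodule L R \<longleftrightarrow>
     cbilinear L \<and> cbilinear R
     \<and> (\<exists>C. \<forall>a v. norm (L a v) \<le> C * norm a * norm v)
     \<and> (\<exists>C. \<forall>a v. norm (R a v) \<le> C * norm a * norm v)
     \<and> L 1 = id \<and> R 1 = id
     \<and> (\<forall>a b. L (a * b) = L a \<circ> L b) \<and> (\<forall>a b. R (a * b) = R b \<circ> R a)
     \<and> (\<forall>a b. L a \<circ> R b = R b \<circ> L a)"

end

theory Submission
  imports Defs
begin

text \<open>In Sweedler notation the Leibniz rule is a short computation.  As \<open>\<Delta>\<close> is multiplicative,
  \<open>\<partial>(ab) = \<Sum> a\<^sub>1 b\<^sub>1 \<xi>\<^sub>h \<otimes> \<eta>(a\<^sub>2 b\<^sub>2)\<close>, and the cocycle identity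
  \<open>\<eta>(xy) = \<pi>(x)\<eta>(y) + \<eta>(x)\<epsilon>(y)\<close> splits this into two sums.  The first,
  \<open>\<Sum> a\<^sub>1 b\<^sub>1 \<xi>\<^sub>h \<otimes> \<pi>(a\<^sub>2) \<eta>(b\<^sub>2)\<close>, is \<open>(\<lambda>\<^sub>L \<otimes> \<pi>)(\<Delta>(a))\<close> applied to
  \<open>\<partial>b\<close>, that is \<open>a \<cdot> \<partial>b\<close>.  In the second, \<open>\<Sum> a\<^sub>1 b\<^sub>1 \<epsilon>(b\<^sub>2) \<xi>\<^sub>h \<otimes> \<eta>(a\<^sub>2)\<close>,
  the counit property \<open>\<Sum> b\<^sub>1 \<epsilon>(b\<^sub>2) = b\<close> leaves
  \<open>\<Sum> a\<^sub>1 b \<xi>\<^sub>h \<otimes> \<eta>(a\<^sub>2) = (\<partial>a) \<cdot> b\<close>.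

  What needs proof is that this notation is meaningful, and there are two points.  The map
  \<open>i\<^sub>h \<otimes> \<eta>\<close> is prescribed on sums of elementary tensors only, so it must be shown to be
  independent of the representation of a tensor (\<open>alg_tensor_map_sum\<close>).  This rests on the linear
  independence property of the tensor product, through \<open>tensor_sum_eq_0_imp\<close>.  Moreover
  linearity and the cocycle identity of \<open>\<eta>\<close> are known on the Hopf algebra alone, so \<open>\<Delta>(a)\<close>
  must have a representation with legs in it (\<open>comultiplication_hopf_algebra\<close>), and the products
  of such legs must remain in it (\<open>hopf_algebra_mult\<close>, by tensor products of
  corepresentations).\<close>

section \<open>Linear and bilinear maps on subspaces\<close>

lemma clinear_sum:
  assumes "clinear f"
  shows "f (\<Sum>i\<in>I. x i) = (\<Sum>i\<in>I. f (x i))"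
proof -
  interpret Vector_Spaces.linear scaleC scaleC f by (fact assms)
  show ?thesis by (rule sum)
qed

lemma clinear_scaleC: "clinear f \<Longrightarrow> f (c *\<^sub>C x) = c *\<^sub>C f x"
  by (simp add: Vector_Spaces.linear_iff)

lemma clinear_add: "clinear f \<Longrightarrow> f (x + y) = f x + f y"
  by (simp add: Vector_Spaces.linear_iff)

lemma clinear_imp_clinear_on: "clinear f \<Longrightarrow> clinear_on S f"
  by (simp add: clinear_on_def clinear_add clinear_scaleC)

lemma clinear_on_0:
  assumes "complex_vector.subspace S" "clinear_on S f"
  shows "f 0 = 0"
proof -
  have "0 \<in> S" using assms(1) by (rule complex_vector.subspace_0)
  then have "f (0 *\<^sub>C 0) = 0 *\<^sub>C f 0" using assms(2) unfolding clinear_on_def by blast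
  then show ?thesis by (simp add: complex_vector.scale_zero_left)
qed

lemma clinear_on_sum:
  assumes S: "complex_vector.subspace S" and f: "clinear_on S f"
    and "\<And>i. i \<in> I \<Longrightarrow> x i \<in> S"
  shows "f (\<Sum>i\<in>I. c i *\<^sub>C x i) = (\<Sum>i\<in>I. c i *\<^sub>C f (x i))"
  using assms(3)
proof (induction I rule: infinite_finite_induct)
  case (insert i I)
  have "c i *\<^sub>C x i \<in> S" "(\<Sum>i\<in>I. c i *\<^sub>C x i) \<in> S"
    using insert.prems by (auto intro!: complex_vector.subspace_sum complex_vector.subspace_scale S)
  then show ?case
    using insert f by (simp add: clinear_on_def)
qed (simp_all add: clinear_on_0[OF S f])

text \<open>The map \<open>(a, b) \<mapsto> a\<xi>\<^sub>h \<otimes> \<eta>(b)\<close> is linear in \<open>b\<close> only on the Hopf algebra, so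
  bilinearity has to be relativised to a pair of subspaces.\<close>

definition cbilinear_on ::
    "'a::complex_vector set \<Rightarrow> 'b::complex_vector set \<Rightarrow> ('a \<Rightarrow> 'b \<Rightarrow> 'c::complex_vector) \<Rightarrow> bool" where
  "cbilinear_on S T f \<longleftrightarrow> (\<forall>y\<in>T. clinear_on S (\<lambda>x. f x y)) \<and> (\<forall>x\<in>S. clinear_on T (f x))"

lemma cbilinear_imp_cbilinear_on: "cbilinear f \<Longrightarrow> cbilinear_on S T f"
  by (simp add: cbilinear_def cbilinear_on_def clinear_imp_clinear_on)

section \<open>Bilinear maps factor through the algebraic tensor product\<close>

lemma min_tensor_cbilinear: "min_tensor t \<Longrightarrow> cbilinear t"
  by (simp add: min_tensor_def)

lemma min_tensor_mult: "min_tensor t \<Longrightarrow> t a b * t a' b' = t (a * a') (b * b')"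
  by (rule min_tensor_def[THEN iffD1, THEN conjunct2, THEN conjunct1, rule_format])

text \<open>Finite sets are the convenient indices for a basis, whereas the defining property of a tensor
  product is phrased for injective enumerations.\<close>

lemma min_tensor_independent:
  assumes t: "min_tensor t" and "finite B" "cindependent B"
    and 0: "(\<Sum>e\<in>B. t (g e) e) = 0" and "e \<in> B"
  shows "g e = 0"
proof -
  obtain k where k: "bij_betw k {0..<card B} B"
    using ex_bij_betw_nat_finite \<open>finite B\<close> by blast
  then have k: "bij_betw k {..<card B} B" by (simp add: atLeast0LessThan)
  have inj: "inj_on k {..<card B}" and img: "k ` {..<card B} = B"
    using k by (auto simp: bij_betw_def)
  have "(\<Sum>i<card B. t (g (k i)) (k i)) = 0"
    using 0 sum.reindex_bij_betw[OF k, of "\<lambda>e. t (g e) e"] by simp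
  moreover have "\<forall>(n::nat) a b. inj_on b {..<n} \<longrightarrow> cindependent (b ` {..<n}) \<longrightarrow>
      (\<Sum>i<n. t (a i) (b i)) = 0 \<longrightarrow> (\<forall>i<n. a i = 0)"
    using t unfolding min_tensor_def by blast
  ultimately have "\<forall>i<card B. g (k i) = 0"
    using inj img \<open>cindependent B\<close>
    by (elim allE[where x="card B"] allE[where x="\<lambda>i. g (k i)"] allE[where x=k]) simp
  moreover obtain i where "i < card B" "e = k i" using img \<open>e \<in> B\<close> by blast
  ultimately show ?thesis by simp
qed

text \<open>Expanding the right tensor factors in terms of a set \<open>B\<close> gathers everything into one left
  coefficient per element of \<open>B\<close>; this holds for \<open>\<otimes>\<close> and for \<open>f\<close> with the same coefficients,
  and that is how a relation among tensors is carried over to \<open>f\<close>.\<close>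

lemma cbilinear_on_sum_expand:
  assumes S: "complex_vector.subspace S" and T: "complex_vector.subspace T"
    and f: "cbilinear_on S T f"
    and a: "\<And>i. i \<in> I \<Longrightarrow> a i \<in> S" and B: "B \<subseteq> T"
    and b: "\<And>i. i \<in> I \<Longrightarrow> b i = (\<Sum>e\<in>B. r i e *\<^sub>C e)"
  shows "(\<Sum>i\<in>I. f (a i) (b i)) = (\<Sum>e\<in>B. f (\<Sum>i\<in>I. r i e *\<^sub>C a i) e)"
proof -
  have "(\<Sum>i\<in>I. f (a i) (b i)) = (\<Sum>i\<in>I. \<Sum>e\<in>B. r i e *\<^sub>C f (a i) e)"
  proof (rule sum.cong[OF refl])
    fix i assume i: "i \<in> I"
    have "clinear_on T (f (a i))" using f a[OF i] by (simp add: cbilinear_on_def)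
    then show "f (a i) (b i) = (\<Sum>e\<in>B. r i e *\<^sub>C f (a i) e)"
      using clinear_on_sum[OF T, of _ B "\<lambda>e. e"] B b[OF i] by auto
  qed
  also have "\<dots> = (\<Sum>e\<in>B. \<Sum>i\<in>I. r i e *\<^sub>C f (a i) e)"
    by (rule sum.swap)
  also have "\<dots> = (\<Sum>e\<in>B. f (\<Sum>i\<in>I. r i e *\<^sub>C a i) e)"
  proof (rule sum.cong[OF refl])
    fix e assume "e \<in> B"
    then have "clinear_on S (\<lambda>x. f x e)" using f B by (auto simp: cbilinear_on_def)
    from clinear_on_sum[OF S this, of I a "\<lambda>i. r i e"] a
    show "(\<Sum>i\<in>I. r i e *\<^sub>C f (a i) e) = f (\<Sum>i\<in>I. r i e *\<^sub>C a i) e" by simp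
  qed
  finally show ?thesis .
qed

text \<open>This is the injectivity of \<open>S \<otimes> T\<close> into the tensor product, in the form in which it makes
  bilinear maps factor.  For a basis \<open>B\<close> of the span of the \<open>b\<^sub>i\<close>, the tensor vanishes only
  if all its left coefficients over \<open>B\<close> vanish, and \<open>f\<close> is computed from these
  coefficients.  Since \<open>B\<close> is chosen among the \<open>b\<^sub>i\<close>, it lies in \<open>T\<close>, where \<open>f\<close> is linear.\<close>

lemma tensor_sum_eq_0_imp:
  assumes t: "min_tensor t" and S: "complex_vector.subspace S" and T: "complex_vector.subspace T"
    and f: "cbilinear_on S T f" and I: "finite I"
    and a: "\<And>i. i \<in> I \<Longrightarrow> a i \<in> S" and b: "\<And>i. i \<in> I \<Longrightarrow> b i \<in> T"
    and 0: "(\<Sum>i\<in>I. t (a i) (b i)) = 0"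
  shows "(\<Sum>i\<in>I. f (a i) (b i)) = 0"
proof -
  obtain B where B: "B \<subseteq> b ` I" "complex_vector.independent B" "b ` I \<subseteq> cspan B"
    by (rule complex_vector.maximal_independent_subset)
  have fin: "finite B" using B(1) I by (meson finite_imageI finite_subset)
  have BT: "B \<subseteq> T" using B(1) b by blast
  define r where "r i = complex_vector.representation B (b i)" for i
  have br: "b i = (\<Sum>e\<in>B. r i e *\<^sub>C e)" if "i \<in> I" for i
    using complex_vector.sum_representation_eq[OF B(2) _ fin subset_refl, of "b i"] B(3) that
    by (auto simp: r_def)
  have expand: "(\<Sum>i\<in>I. g (a i) (b i)) = (\<Sum>e\<in>B. g (\<Sum>i\<in>I. r i e *\<^sub>C a i) e)"
    if "cbilinear_on S T g" for g :: "'a \<Rightarrow> 'b \<Rightarrow> 'z::complex_vector"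
    using cbilinear_on_sum_expand[where I = I and a = a and b = b and B = B and r = r,
        OF S T that _ BT] a br
    by blast
  have "(\<Sum>e\<in>B. t (\<Sum>i\<in>I. r i e *\<^sub>C a i) e) = 0"
    using expand[of t] 0 min_tensor_cbilinear[OF t] by (simp add: cbilinear_imp_cbilinear_on)
  then have "(\<Sum>i\<in>I. r i e *\<^sub>C a i) = 0" if "e \<in> B" for e
    using min_tensor_independent[OF t fin, of "\<lambda>e. \<Sum>i\<in>I. r i e *\<^sub>C a i"] that B(2)
    unfolding cindependent_def by blast
  moreover have "f 0 e = 0" if "e \<in> B" for e
    using clinear_on_0[OF S, of "\<lambda>x. f x e"] f that BT by (auto simp: cbilinear_on_def)
  ultimately show ?thesis
    using expand[OF f] by simp
qed

text \<open>Two representations of one tensor are compared by concatenating the first with the negative of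
  the second, over the disjoint union of the index sets.\<close>

lemma tensor_sum_eq_imp:
  assumes t: "min_tensor t" and S: "complex_vector.subspace S" and T: "complex_vector.subspace T"
    and f: "cbilinear_on S T f" and I: "finite I" and J: "finite J"
    and a: "\<And>i. i \<in> I \<Longrightarrow> a i \<in> S \<and> b i \<in> T"
    and a': "\<And>j. j \<in> J \<Longrightarrow> a' j \<in> S \<and> b' j \<in> T"
    and eq: "(\<Sum>i\<in>I. t (a i) (b i)) = (\<Sum>j\<in>J. t (a' j) (b' j))"
  shows "(\<Sum>i\<in>I. f (a i) (b i)) = (\<Sum>j\<in>J. f (a' j) (b' j))"
proof -
  let ?a = "case_sum a (\<lambda>j. - a' j)" and ?b = "case_sum b b'"
  have neg: "(-1) *\<^sub>C z = - z" for z :: "'z::complex_vector"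
    using complex_vector.scale_minus_left[of 1 z] by (simp add: scaleC_one)
  have diff: "(\<Sum>k\<in>I <+> J. g (?a k) (?b k))
      = (\<Sum>i\<in>I. g (a i) (b i)) - (\<Sum>j\<in>J. g (a' j) (b' j))"
    if g: "cbilinear_on S T g" for g :: "'a \<Rightarrow> 'b \<Rightarrow> 'z::complex_vector"
  proof -
    have "g (- a' j) (b' j) = - g (a' j) (b' j)" if "j \<in> J" for j
    proof -
      have "clinear_on S (\<lambda>x. g x (b' j))" using g a'[OF that] by (simp add: cbilinear_on_def)
      then have "g ((-1) *\<^sub>C a' j) (b' j) = (-1) *\<^sub>C g (a' j) (b' j)"
        using a'[OF that] unfolding clinear_on_def by blast
      then show ?thesis by (simp only: neg)
    qed
    then show ?thesis
      using I J by (simp add: sum.Plus sum_negf o_def)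
  qed
  have "(\<Sum>k\<in>I <+> J. f (?a k) (?b k)) = 0"
  proof (rule tensor_sum_eq_0_imp[OF t S T f])
    show "(\<Sum>k\<in>I <+> J. t (?a k) (?b k)) = 0"
      using diff[OF cbilinear_imp_cbilinear_on[OF min_tensor_cbilinear[OF t]]] eq by simp
  qed (use I J a a' in \<open>auto intro!: complex_vector.subspace_neg[OF S]\<close>)
  then show ?thesis using diff[OF f] by simp
qed

text \<open>The description of the induced map by \<open>THE\<close> is thus legitimate, and the map may be
  evaluated on whichever representation of a tensor is at hand.\<close>

lemma alg_tensor_map_sum:
  assumes t: "min_tensor t" and S: "complex_vector.subspace S" and T: "complex_vector.subspace T"
    and f: "cbilinear_on S T f" and I: "finite I"
    and a: "\<forall>i\<in>I. a i \<in> S \<and> b i \<in> T"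
  shows "alg_tensor_map S T t f (\<Sum>i\<in>I. t (a i) (b i)) = (\<Sum>i\<in>I. f (a i) (b i))"
  unfolding alg_tensor_map_def
proof (rule the_equality)
  obtain k where "bij_betw k {0..<card I} I"
    using ex_bij_betw_nat_finite I by blast
  then have k: "bij_betw k {..<card I} I" by (simp add: atLeast0LessThan)
  show "\<exists>(n::nat) a' b'. (\<forall>i<n. a' i \<in> S \<and> b' i \<in> T)
      \<and> (\<Sum>i\<in>I. t (a i) (b i)) = (\<Sum>i<n. t (a' i) (b' i))
      \<and> (\<Sum>i\<in>I. f (a i) (b i)) = (\<Sum>i<n. f (a' i) (b' i))"
  proof (intro exI conjI)
    show "\<forall>i<card I. (a \<circ> k) i \<in> S \<and> (b \<circ> k) i \<in> T"
      using k a by (auto simp: bij_betw_def)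
    show "(\<Sum>i\<in>I. t (a i) (b i)) = (\<Sum>i<card I. t ((a \<circ> k) i) ((b \<circ> k) i))"
      using sum.reindex_bij_betw[OF k, of "\<lambda>i. t (a i) (b i)"] by simp
    show "(\<Sum>i\<in>I. f (a i) (b i)) = (\<Sum>i<card I. f ((a \<circ> k) i) ((b \<circ> k) i))"
      using sum.reindex_bij_betw[OF k, of "\<lambda>i. f (a i) (b i)"] by simp
  qed
next
  fix y
  assume "\<exists>(n::nat) a' b'. (\<forall>i<n. a' i \<in> S \<and> b' i \<in> T)
      \<and> (\<Sum>i\<in>I. t (a i) (b i)) = (\<Sum>i<n. t (a' i) (b' i))
      \<and> y = (\<Sum>i<n. f (a' i) (b' i))"
  then obtain n :: nat and a' b' where *: "\<forall>i<n. a' i \<in> S \<and> b' i \<in> T"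
    "(\<Sum>i\<in>I. t (a i) (b i)) = (\<Sum>i<n. t (a' i) (b' i))"
    "y = (\<Sum>i<n. f (a' i) (b' i))" by blast
  show "y = (\<Sum>i\<in>I. f (a i) (b i))"
    using tensor_sum_eq_imp[OF t S T f I finite_lessThan, of a b n a' b'] a * by simp
qed

text \<open>The scalars of a linear combination are absorbed into the left factors.  The elementary tensors
  occurring in it serve as the index set.\<close>

lemma in_span_tensorE:
  fixes t :: "'a::unital_cstar_algebra \<Rightarrow> 'b::unital_cstar_algebra \<Rightarrow> 'c::unital_cstar_algebra"
  assumes t: "min_tensor t" and S: "complex_vector.subspace S"
    and "z \<in> cspan {t x y | x y. x \<in> S \<and> y \<in> T}"
  obtains I :: "'c set" and a b where
    "finite I" "\<forall>i\<in>I. a i \<in> S \<and> b i \<in> T" "z = (\<Sum>i\<in>I. t (a i) (b i))"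
proof -
  obtain I r where I: "finite I" "I \<subseteq> {t x y | x y. x \<in> S \<and> y \<in> T}"
    and z: "z = (\<Sum>i\<in>I. r i *\<^sub>C i)"
    using assms(3) unfolding complex_vector.span_explicit by blast
  have "\<forall>i\<in>I. \<exists>x y. x \<in> S \<and> y \<in> T \<and> i = t x y" using I(2) by blast
  then obtain a b where ab: "\<And>i. i \<in> I \<Longrightarrow> a i \<in> S \<and> b i \<in> T \<and> i = t (a i) (b i)"
    by metis
  have lin: "t (c *\<^sub>C x) y = c *\<^sub>C t x y" for c x y
    using min_tensor_cbilinear[OF t] clinear_scaleC[of "\<lambda>x. t x y"] by (simp add: cbilinear_def)
  show ?thesis
  proof (rule that[of I "\<lambda>i. r i *\<^sub>C a i" b])
    show "z = (\<Sum>i\<in>I. t (r i *\<^sub>C a i) (b i))"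
      unfolding z lin by (intro sum.cong) (use ab in auto)
  qed (use I(1) ab S in \<open>auto intro: complex_vector.subspace_scale\<close>)
qed

lemma clinear_on_alg_tensor_map:
  fixes t :: "'a::unital_cstar_algebra \<Rightarrow> 'b::unital_cstar_algebra \<Rightarrow> 'c::unital_cstar_algebra"
  assumes t: "min_tensor t" and S: "complex_vector.subspace S" and T: "complex_vector.subspace T"
    and f: "cbilinear_on S T f"
  shows "clinear_on (cspan {t x y | x y. x \<in> S \<and> y \<in> T}) (alg_tensor_map S T t f)"
  unfolding clinear_on_def
proof (intro conjI ballI allI)
  fix z w
  assume z: "z \<in> cspan {t x y | x y. x \<in> S \<and> y \<in> T}"
    and w: "w \<in> cspan {t x y | x y. x \<in> S \<and> y \<in> T}"
  obtain I :: "'c set" and a b where I: "finite I" "\<forall>i\<in>I. a i \<in> S \<and> b i \<in> T"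
      "z = (\<Sum>i\<in>I. t (a i) (b i))"
    by (rule in_span_tensorE[OF t S z])
  obtain J :: "'c set" and a' b' where J: "finite J" "\<forall>j\<in>J. a' j \<in> S \<and> b' j \<in> T"
      "w = (\<Sum>j\<in>J. t (a' j) (b' j))"
    by (rule in_span_tensorE[OF t S w])
  let ?a = "case_sum a a'" and ?b = "case_sum b b'"
  have mem: "\<forall>k\<in>I <+> J. ?a k \<in> S \<and> ?b k \<in> T" using I(2) J(2) by auto
  have "z + w = (\<Sum>k\<in>I <+> J. t (?a k) (?b k))"
    using I J by (simp add: sum.Plus o_def)
  then have "alg_tensor_map S T t f (z + w) = (\<Sum>k\<in>I <+> J. f (?a k) (?b k))"
    using alg_tensor_map_sum[OF t S T f _ mem] I(1) J(1) by simp
  also have "\<dots> = (\<Sum>i\<in>I. f (a i) (b i)) + (\<Sum>j\<in>J. f (a' j) (b' j))"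
    using I J by (simp add: sum.Plus o_def)
  also have "\<dots> = alg_tensor_map S T t f z + alg_tensor_map S T t f w"
    unfolding I(3) J(3) by (simp add: alg_tensor_map_sum[OF t S T f] I J)
  finally show "alg_tensor_map S T t f (z + w) = alg_tensor_map S T t f z + alg_tensor_map S T t f w" .
next
  fix c z
  assume z: "z \<in> cspan {t x y | x y. x \<in> S \<and> y \<in> T}"
  obtain I :: "'c set" and a b where I: "finite I" "\<forall>i\<in>I. a i \<in> S \<and> b i \<in> T"
      "z = (\<Sum>i\<in>I. t (a i) (b i))"
    by (rule in_span_tensorE[OF t S z])
  have scale: "c *\<^sub>C (\<Sum>i\<in>I. g (a i) (b i)) = (\<Sum>i\<in>I. g (c *\<^sub>C a i) (b i))"
    if "cbilinear_on S T g" for g :: "'a \<Rightarrow> 'b \<Rightarrow> 'z::complex_vector"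
    unfolding complex_vector.scale_sum_right
    by (intro sum.cong) (use I that in \<open>auto simp: cbilinear_on_def clinear_on_def\<close>)
  have "c *\<^sub>C z = (\<Sum>i\<in>I. t (c *\<^sub>C a i) (b i))"
    unfolding I(3) by (rule scale[OF cbilinear_imp_cbilinear_on[OF min_tensor_cbilinear[OF t]]])
  then have "alg_tensor_map S T t f (c *\<^sub>C z) = (\<Sum>i\<in>I. f (c *\<^sub>C a i) (b i))"
    using alg_tensor_map_sum[OF t S T f I(1), of "\<lambda>i. c *\<^sub>C a i" b] I(2)
    by (simp add: complex_vector.subspace_scale[OF S])
  also have "\<dots> = c *\<^sub>C alg_tensor_map S T t f z"
    unfolding I(3) by (simp add: alg_tensor_map_sum[OF t S T f] I scale[OF f])
  finally show "alg_tensor_map S T t f (c *\<^sub>C z) = c *\<^sub>C alg_tensor_map S T t f z" .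
qed

section \<open>The Hopf algebra of matrix coefficients\<close>

lemma subspace_hopf_algebra: "complex_vector.subspace (hopf_algebra t2 \<Delta>)"
  unfolding hopf_algebra_def by (rule complex_vector.subspace_span)

lemma corep_coefficient_in_hopf_algebra:
  "unitary_corep t2 \<Delta> n u \<Longrightarrow> i < n \<Longrightarrow> j < n \<Longrightarrow> u i j \<in> hopf_algebra t2 \<Delta>"
  unfolding hopf_algebra_def by (rule complex_vector.span_base) blast

text \<open>Span induction in which each generator comes with a corepresentation that it is a coefficient of;
  this makes the remaining coefficients of that corepresentation accessible in the induction step.\<close>

lemma hopf_algebra_induct [consumes 1, case_names zero add]:
  assumes "a \<in> hopf_algebra t2 \<Delta>" and "P 0"
    and add: "\<And>c n u i j x z. unitary_corep t2 \<Delta> n u \<Longrightarrow> i < n \<Longrightarrow> j < n \<Longrightarrow> x = u i j \<Longrightarrow> P z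
      \<Longrightarrow> P (c *\<^sub>C x + z)"
  shows "P a"
  using assms(1) unfolding hopf_algebra_def
proof (induction a rule: complex_vector.span_induct_alt)
  case (step c x z)
  from step(1) have "\<exists>n u i j. x = u i j \<and> unitary_corep t2 \<Delta> n u \<and> i < n \<and> j < n"
    by (simp only: mem_Collect_eq)
  then show ?case
    by (elim exE conjE) (rule add[OF _ _ _ _ step(2)], assumption, assumption, assumption, assumption)
qed (rule assms(2))

text \<open>Division with remainder identifies \<open>{..<nm}\<close> with \<open>{..<n} \<times> {..<m}\<close>; it is used to
  number the basis of a tensor product of corepresentations.\<close>

lemma sum_div_mod:
  fixes g :: "nat \<Rightarrow> nat \<Rightarrow> 'z::comm_monoid_add"
  shows "(\<Sum>p<n * m. g (p div m) (p mod m)) = (\<Sum>k<n. \<Sum>l<m. g k l)"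
proof -
  have "(\<Sum>p<n * m. g (p div m) (p mod m)) = (\<Sum>k<n. \<Sum>p = k * m..<k * m + m. g (p div m) (p mod m))"
    by (simp add: sum.nat_group)
  also have "\<dots> = (\<Sum>k<n. \<Sum>l<m. g k l)"
  proof (rule sum.cong[OF refl])
    fix k
    show "(\<Sum>p = k * m..<k * m + m. g (p div m) (p mod m)) = (\<Sum>l<m. g k l)"
    proof (rule sum.reindex_bij_witness[of _ "\<lambda>l. k * m + l" "\<lambda>p. p - k * m"])
      fix p assume p: "p \<in> {k * m..<k * m + m}"
      then have "p div m = k" by (intro div_nat_eqI) (auto simp: mult.commute)
      then show "g k (p - k * m) = g (p div m) (p mod m)"
        by (simp add: minus_div_mult_eq_mod[symmetric])
    qed auto
  qed
  finally show ?thesis .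
qed

text \<open>The tensor product \<open>w\<close> of two corepresentations has the entries
  \<open>w\<^bsub>(i,k),(j,l)\<^esub> = u\<^sub>i\<^sub>j v\<^sub>k\<^sub>l\<close>.  Because the algebra is noncommutative, unitarity
  uses the two relations in a fixed order: in \<open>w\<^sup>*w\<close> the inner product \<open>u\<^sup>*u\<close> collapses first,
  in \<open>ww\<^sup>*\<close> it is \<open>vv\<^sup>*\<close>.\<close>

lemma unitary_corep_tensor:
  assumes t: "min_tensor t2" and \<Delta>: "unital_star_hom \<Delta>"
    and u: "unitary_corep t2 \<Delta> n u" and v: "unitary_corep t2 \<Delta> m v"
  shows "unitary_corep t2 \<Delta> (n * m) (\<lambda>p q. u (p div m) (q div m) * v (p mod m) (q mod m))"
    (is "unitary_corep _ _ _ ?w")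
  unfolding unitary_corep_def
proof (intro conjI allI impI)
  fix p q assume pq: "p < n * m" "q < n * m"
  let ?i = "p div m" and ?j = "q div m" and ?x = "p mod m" and ?y = "q mod m"
  have lt: "?i < n" "?j < n" "?x < m" "?y < m"
    using pq by (auto simp: less_mult_imp_div_less intro!: mod_less_divisor gr0I)
  have eq_iff: "p = q \<longleftrightarrow> ?i = ?j \<and> ?x = ?y"
    by (metis div_mult_mod_eq)
  have "(\<Sum>r<n * m. star (?w r p) * ?w r q)
      = (\<Sum>k<n. \<Sum>l<m. star (v l ?x) * (star (u k ?i) * u k ?j) * v l ?y)"
    by (simp add: sum_div_mod[symmetric] star_mult mult.assoc)
  also have "\<dots> = (\<Sum>l<m. star (v l ?x) * (\<Sum>k<n. star (u k ?i) * u k ?j) * v l ?y)"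
    unfolding sum_distrib_left sum_distrib_right by (rule sum.swap)
  also have "\<dots> = (if p = q then 1 else 0)"
    using u v lt unfolding unitary_corep_def by (simp add: eq_iff)
  finally show "(\<Sum>r<n * m. star (?w r p) * ?w r q) = (if p = q then 1 else 0)" .
  have "(\<Sum>r<n * m. ?w p r * star (?w q r))
      = (\<Sum>k<n. \<Sum>l<m. u ?i k * (v ?x l * star (v ?y l)) * star (u ?j k))"
    by (simp add: sum_div_mod[symmetric] star_mult mult.assoc)
  also have "\<dots> = (\<Sum>k<n. u ?i k * (\<Sum>l<m. v ?x l * star (v ?y l)) * star (u ?j k))"
    by (simp add: sum_distrib_left sum_distrib_right)
  also have "\<dots> = (if p = q then 1 else 0)"
    using u v lt unfolding unitary_corep_def by (simp add: eq_iff)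
  finally show "(\<Sum>r<n * m. ?w p r * star (?w q r)) = (if p = q then 1 else 0)" .
  have "\<Delta> (?w p q) = \<Delta> (u ?i ?j) * \<Delta> (v ?x ?y)"
    using \<Delta> by (simp add: unital_star_hom_def)
  also have "\<dots> = (\<Sum>k<n. t2 (u ?i k) (u k ?j)) * (\<Sum>l<m. t2 (v ?x l) (v l ?y))"
    using u v lt unfolding unitary_corep_def by simp
  also have "\<dots> = (\<Sum>k<n. \<Sum>l<m. t2 (u ?i k * v ?x l) (u k ?j * v l ?y))"
    by (simp add: sum_product min_tensor_mult[OF t])
  also have "\<dots> = (\<Sum>r<n * m. t2 (?w p r) (?w r q))"
    by (simp add: sum_div_mod[symmetric])
  finally show "\<Delta> (?w p q) = (\<Sum>r<n * m. t2 (?w p r) (?w r q))" .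
qed

text \<open>A product of coefficients is a coefficient of the tensor product corepresentation.\<close>

lemma hopf_algebra_mult:
  assumes t: "min_tensor t2" and \<Delta>: "unital_star_hom \<Delta>"
    and a: "a \<in> hopf_algebra t2 \<Delta>" and b: "b \<in> hopf_algebra t2 \<Delta>"
  shows "a * b \<in> hopf_algebra t2 \<Delta>"
proof -
  note closed = complex_vector.subspace_0[OF subspace_hopf_algebra]
    complex_vector.subspace_add[OF subspace_hopf_algebra]
    complex_vector.subspace_scale[OF subspace_hopf_algebra]
  have coefficients: "u i j * v k l \<in> hopf_algebra t2 \<Delta>"
    if u: "unitary_corep t2 \<Delta> n u" "i < n" "j < n" and v: "unitary_corep t2 \<Delta> m v" "k < m" "l < m"
    for n m u v i j k l
  proof -
    have less: "r * m + s < n * m" if "r < n" "s < m" for r s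
    proof -
      have "r * m + s < Suc r * m" using that by simp
      also have "\<dots> \<le> n * m" using that by (intro mult_right_mono) auto
      finally show ?thesis .
    qed
    from corep_coefficient_in_hopf_algebra[OF unitary_corep_tensor[OF t \<Delta> u(1) v(1)]
        less[OF u(2) v(2)] less[OF u(3) v(3)]]
    show ?thesis using v by simp
  qed
  have right: "u i j * b \<in> hopf_algebra t2 \<Delta>"
    if "unitary_corep t2 \<Delta> n u" "i < n" "j < n" for n u i j
    using b
  proof (induction b rule: hopf_algebra_induct)
    case zero
    show ?case by (simp add: closed)
  next
    case (add c m v k l x z)
    from coefficients[OF that add(1-3)] show ?case
      using add(4,5) by (simp add: distrib_left mult_scaleC_right closed)
  qed
  show ?thesis
    using a
  proof (induction a rule: hopf_algebra_induct)
    case zero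
    show ?case by (simp add: closed)
  next
    case (add c n u i j x z)
    from right[OF add(1-3)] show ?case
      using add(4,5) by (simp add: distrib_right mult_scaleC_left closed)
  qed
qed

text \<open>For a coefficient, \<open>\<Delta>(u\<^sub>i\<^sub>j) = \<Sum> u\<^sub>i\<^sub>k \<otimes> u\<^sub>k\<^sub>j\<close> has both legs in the
  Hopf algebra.  This is what provides Sweedler's notation: every \<open>\<Delta>(a)\<close> is a finite sum of
  elementary tensors on which the map induced by a bilinear map can be evaluated.\<close>

lemma comultiplication_hopf_algebra:
  assumes \<Delta>: "unital_star_hom \<Delta>" and a: "a \<in> hopf_algebra t2 \<Delta>"
  shows "\<Delta> a \<in> cspan {t2 x y | x y. x \<in> hopf_algebra t2 \<Delta> \<and> y \<in> hopf_algebra t2 \<Delta>}"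
    (is "_ \<in> ?T")
proof -
  have lin: "clinear \<Delta>" using \<Delta> by (simp add: unital_star_hom_def)
  show ?thesis
    using a
  proof (induction a rule: hopf_algebra_induct)
    case zero
    have "\<Delta> 0 = 0"
      using clinear_on_0[OF complex_vector.subspace_UNIV clinear_imp_clinear_on[OF lin]] .
    then show ?case by (simp add: complex_vector.span_zero)
  next
    case (add c n u i j x z)
    have "\<Delta> x = (\<Sum>k<n. t2 (u i k) (u k j))"
      using add unfolding unitary_corep_def by simp
    also have "\<dots> \<in> ?T"
      using corep_coefficient_in_hopf_algebra[OF add(1)] add(2,3)
      by (intro complex_vector.span_sum complex_vector.span_base) blast
    finally have "\<Delta> x \<in> ?T" .
    then show ?case
      using add by (simp add: clinear_add[OF lin] clinear_scaleC[OF lin]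
          complex_vector.span_add complex_vector.span_scale)
  qed
qed

section \<open>The Leibniz rule\<close>

theorem proposition8p1:
  fixes t2 :: "'a::unital_cstar_algebra \<Rightarrow> 'a \<Rightarrow> 'aa::unital_cstar_algebra"
    and tL :: "'aa \<Rightarrow> 'a \<Rightarrow> 'aaa::unital_cstar_algebra"
    and tR :: "'a \<Rightarrow> 'aa \<Rightarrow> 'aaa"
    and \<Delta> :: "'a \<Rightarrow> 'aa"
    and h \<epsilon> \<phi> :: "'a \<Rightarrow> complex"
    and lam_L lam_R :: "'a \<Rightarrow> 'l::chilbert_space \<Rightarrow> 'l"
    and \<xi>\<^sub>h :: 'l
    and i\<^sub>h :: "'a \<Rightarrow> 'l"
    and \<pi> :: "'a \<Rightarrow> 'h::chilbert_space \<Rightarrow> 'h"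
    and \<eta> :: "'a \<Rightarrow> 'h"
    and tH :: "'l \<Rightarrow> 'h \<Rightarrow> 'k::chilbert_space"
    and lam_L_\<pi> :: "'aa \<Rightarrow> 'k \<Rightarrow> 'k"
    and \<rho>\<^sub>L \<rho>\<^sub>R :: "'a \<Rightarrow> 'k \<Rightarrow> 'k"
    and \<A> :: "'a set"
    and d :: "'a \<Rightarrow> 'k"
  assumes "compact_quantum_group t2 tL tR \<Delta>"
    and "haar_state t2 \<Delta> h" and "faithful h"
    and "gns h lam_L \<xi>\<^sub>h" and "i\<^sub>h = (\<lambda>a. lam_L a \<xi>\<^sub>h)"
    and "\<A> = hopf_algebra t2 \<Delta>"
    and "counit t2 \<Delta> \<epsilon>"
    and "generating_functional t2 \<Delta> \<epsilon> \<phi>"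
    and "schuermann_triple t2 \<Delta> \<epsilon> \<pi> \<eta> \<phi>"
    and "hilbert_tensor tH"
    and "is_tensor_rep t2 tH lam_L \<pi> lam_L_\<pi>" and "\<rho>\<^sub>L = lam_L_\<pi> \<circ> \<Delta>"
    and "\<And>a. bounded_clinear (lam_R a)" and "\<And>a b. lam_R a (i\<^sub>h b) = i\<^sub>h (b * a)"
    and "\<And>a. is_tensor_op tH (lam_R a) id (\<rho>\<^sub>R a)"
    and "hilbert_bimodule \<rho>\<^sub>L \<rho>\<^sub>R"
    and "d = alg_tensor_map \<A> \<A> t2 (\<lambda>a b. tH (i\<^sub>h a) (\<eta> b)) \<circ> \<Delta>"
  shows "clinear_on \<A> d \<and> (\<forall>a\<in>\<A>. \<forall>b\<in>\<A>. d (a * b) = \<rho>\<^sub>R b (d a) + \<rho>\<^sub>L a (d b))"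
proof -
  note cqg = assms(1) and gns = assms(4) and i_def = assms(5) and A = assms(6)
  have t: "min_tensor t2" and \<Delta>: "unital_star_hom \<Delta>"
    using cqg by (auto simp: compact_quantum_group_def)
  have \<Delta>_lin: "clinear \<Delta>" and \<Delta>_mult: "\<Delta> (a * b) = \<Delta> a * \<Delta> b" for a b
    using \<Delta> by (auto simp: unital_star_hom_def)
  have sub: "complex_vector.subspace \<A>" unfolding A by (rule subspace_hopf_algebra)
  have A_mult: "a * b \<in> \<A>" if "a \<in> \<A>" "b \<in> \<A>" for a b
    using hopf_algebra_mult[OF t \<Delta>] that unfolding A by blast
  let ?T = "cspan {t2 x y | x y. x \<in> \<A> \<and> y \<in> \<A>}"
  have \<Delta>_in: "\<Delta> a \<in> ?T" if "a \<in> \<A>" for a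
    using comultiplication_hopf_algebra[OF \<Delta>] that unfolding A by blast
  have lam: "star_rep lam_L" using gns by (simp add: gns_def)
  have i_lin: "clinear i\<^sub>h" using lam by (simp add: i_def star_rep_def)
  have i_mult: "i\<^sub>h (a * b) = lam_L a (i\<^sub>h b)" for a b
    using lam by (simp add: i_def star_rep_def)
  have \<epsilon>_lin: "clinear_on \<A> \<epsilon>"
    and counit: "\<And>a. a \<in> \<A> \<Longrightarrow> alg_tensor_map \<A> \<A> t2 (\<lambda>x y. \<epsilon> y *\<^sub>C x) (\<Delta> a) = a"
    using assms(7) unfolding counit_def Let_def A by blast+
  have \<eta>_lin: "clinear_on \<A> \<eta>"
    and \<eta>_mult: "\<And>a b. a \<in> \<A> \<Longrightarrow> b \<in> \<A> \<Longrightarrow> \<eta> (a * b) = \<pi> a (\<eta> b) + \<epsilon> b *\<^sub>C \<eta> a"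
    using assms(9) unfolding schuermann_triple_def Let_def A by blast+
  have tH1: "clinear (\<lambda>x. tH x y)" and tH2: "clinear (tH x)" for x y
    using assms(10) by (auto simp: hilbert_tensor_def cbilinear_def)
  have rep_lin: "clinear (\<lambda>z. lam_L_\<pi> z v)" "clinear (lam_L_\<pi> z)"
    and rep: "lam_L_\<pi> (t2 x y) (tH v' w) = tH (lam_L x v') (\<pi> y w)" for z v v' w x y
    using assms(11) by (auto simp: is_tensor_rep_def star_rep_def is_tensor_op_def bounded_clinear_def)
  have R_lin: "clinear (\<rho>\<^sub>R b)" and R: "\<rho>\<^sub>R b (tH v w) = tH (lam_R b v) w" for b v w
    using assms(15) by (auto simp: is_tensor_op_def bounded_clinear_def)
  let ?f = "\<lambda>a b. tH (i\<^sub>h a) (\<eta> b)"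
  have f: "cbilinear_on \<A> \<A> ?f"
    using \<eta>_lin
    by (auto simp: cbilinear_on_def clinear_on_def clinear_add[OF i_lin] clinear_scaleC[OF i_lin]
        clinear_add[OF tH1] clinear_scaleC[OF tH1] clinear_add[OF tH2] clinear_scaleC[OF tH2])
  have g: "cbilinear_on \<A> \<A> (\<lambda>x y. \<epsilon> y *\<^sub>C x)"
    using \<epsilon>_lin
    by (auto simp: cbilinear_on_def clinear_on_def scaleC_add_right scaleC_add_left scaleC_scaleC
        scaleC_complex_def mult.commute)
  have d: "d a = alg_tensor_map \<A> \<A> t2 ?f (\<Delta> a)" for a
    using assms(17) by simp
  have "clinear_on \<A> d"
    using clinear_on_alg_tensor_map[OF t sub sub f] \<Delta>_in
    by (simp add: clinear_on_def d clinear_add[OF \<Delta>_lin] clinear_scaleC[OF \<Delta>_lin])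
  moreover have "d (a * b) = \<rho>\<^sub>R b (d a) + \<rho>\<^sub>L a (d b)" if a: "a \<in> \<A>" and b: "b \<in> \<A>" for a b
  proof -
    obtain I :: "'aa set" and x x' where I: "finite I" "\<forall>i\<in>I. x i \<in> \<A> \<and> x' i \<in> \<A>"
      and \<Delta>a: "\<Delta> a = (\<Sum>i\<in>I. t2 (x i) (x' i))"
      by (rule in_span_tensorE[OF t sub \<Delta>_in[OF a]])
    obtain J :: "'aa set" and y y' where J: "finite J" "\<forall>j\<in>J. y j \<in> \<A> \<and> y' j \<in> \<A>"
      and \<Delta>b: "\<Delta> b = (\<Sum>j\<in>J. t2 (y j) (y' j))"
      by (rule in_span_tensorE[OF t sub \<Delta>_in[OF b]])
    have da: "d a = (\<Sum>i\<in>I. ?f (x i) (x' i))"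
      unfolding d \<Delta>a by (rule alg_tensor_map_sum[OF t sub sub f I])
    have db: "d b = (\<Sum>j\<in>J. ?f (y j) (y' j))"
      unfolding d \<Delta>b by (rule alg_tensor_map_sum[OF t sub sub f J])
    \<comment> \<open>The counit axiom \<open>b = \<Sum> b\<^sub>1 \<epsilon>(b\<^sub>2)\<close>, read off the chosen representation of \<open>\<Delta>(b)\<close>.\<close>
    have b_eq: "b = (\<Sum>j\<in>J. \<epsilon> (y' j) *\<^sub>C y j)"
      using alg_tensor_map_sum[OF t sub sub g J] counit[OF b] unfolding \<Delta>b by simp
    have "\<Delta> (a * b) = (\<Sum>(i, j)\<in>I \<times> J. t2 (x i * y j) (x' i * y' j))"
      by (simp add: \<Delta>_mult \<Delta>a \<Delta>b sum_product min_tensor_mult[OF t] sum.cartesian_product)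
    then have "d (a * b) = (\<Sum>(i, j)\<in>I \<times> J. ?f (x i * y j) (x' i * y' j))"
      using alg_tensor_map_sum[OF t sub sub f, of "I \<times> J" "\<lambda>(i, j). x i * y j" "\<lambda>(i, j). x' i * y' j"]
        I J A_mult by (auto simp: d case_prod_unfold)
    also have "\<dots> = (\<Sum>i\<in>I. \<Sum>j\<in>J. ?f (x i * y j) (x' i * y' j))"
      by (simp add: sum.cartesian_product)
    \<comment> \<open>The cocycle identity for \<open>\<eta>\<close>; the scalar \<open>\<epsilon>(y'\<^sub>j)\<close> is moved to the left leg, next to \<open>y\<^sub>j\<close>.\<close>
    also have "\<dots> = (\<Sum>i\<in>I. \<Sum>j\<in>J. tH (i\<^sub>h (x i * (\<epsilon> (y' j) *\<^sub>C y j))) (\<eta> (x' i))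
        + tH (lam_L (x i) (i\<^sub>h (y j))) (\<pi> (x' i) (\<eta> (y' j))))"
      using I J
      by (intro sum.cong) (auto simp: \<eta>_mult clinear_add[OF tH2] clinear_scaleC[OF tH2]
          clinear_scaleC[OF tH1] clinear_scaleC[OF i_lin] mult_scaleC_right i_mult[symmetric])
    also have "\<dots> = (\<Sum>i\<in>I. \<Sum>j\<in>J. tH (i\<^sub>h (x i * (\<epsilon> (y' j) *\<^sub>C y j))) (\<eta> (x' i)))
        + (\<Sum>i\<in>I. \<Sum>j\<in>J. tH (lam_L (x i) (i\<^sub>h (y j))) (\<pi> (x' i) (\<eta> (y' j))))"
      by (simp add: sum.distrib)
    also have "(\<Sum>i\<in>I. \<Sum>j\<in>J. tH (i\<^sub>h (x i * (\<epsilon> (y' j) *\<^sub>C y j))) (\<eta> (x' i)))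
        = (\<Sum>i\<in>I. tH (i\<^sub>h (x i * b)) (\<eta> (x' i)))"
      by (subst b_eq)
        (simp only: sum_distrib_left clinear_sum[OF i_lin] clinear_sum[OF tH1])
    also have "\<dots> = \<rho>\<^sub>R b (d a)"
      by (simp add: da clinear_sum[OF R_lin] R assms(14))
    also have "(\<Sum>i\<in>I. \<Sum>j\<in>J. tH (lam_L (x i) (i\<^sub>h (y j))) (\<pi> (x' i) (\<eta> (y' j)))) = \<rho>\<^sub>L a (d b)"
      by (simp add: assms(12) \<Delta>a db clinear_sum[OF rep_lin(1)] clinear_sum[OF rep_lin(2)] rep
          sum.swap[of _ J I])
    finally show ?thesis .
  qed
  ultimately show ?thesis by blast
qed

end
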